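(* Let $n \ge 5$ be an integer. Let $\mathcal{N}_{\min}$ be the minimum nullity among all connected quartic circulant graphs of order $n$, i.e. among the connected graphs $\mathrm{Circ}(n, \{p, q\})$ with integers $1 \le p < q < \frac{n}{2}$. Then the following hold, where "attains" refers to connected quartic circulant graphs of order $n$ having nullity $\mathcal{N}_{\min}$. (1) If $n$ is odd, then $\mathcal{N}_{\min} = 0$; the graphs $\mathrm{Circ}(n, \{p, q\})$, $1 \le p < q < \frac{n}{2}$, attaining it are exactly those with $\gcd(p, q, n) = 1$, and the corresponding null spaces are trivial. (2) If $n = 6$, then $\mathcal{N}_{\min} = 3$; it is attained by the graph with $p = 1$, $q = 2$ (the only such graph), and its null space is \[ \mathrm{span}\left( (1,0,0,-1,0,0)^{\mathrm T},\ (0,1,0,0,-1,0)^{\mathrm T},\ (0,0,1,0,0,-1)^{\mathrm T} \right). \] (3) If $n \ge 8$ and $4 \mid n$, then $\mathcal{N}_{\min} = 1$; the graphs $\mathrm{Circ}(n, \{p, q\})$, $1 \le p < q < \frac{n}{2}$, attaining it are exactly those with $p \not\equiv q \pmod 2$ and $\gcd(n, p+q) = \gcd(n, q-p) = 1$, and the null space of each such graph is \[ \mathrm{span}\left( (1, -1, 1, -1, \ldots, 1, -1)^{\mathrm T} \right). \] (4) If $n \ge 10$ and $n \equiv 2 \pmod 4$, then $\mathcal{N}_{\min} = 0$; the graphs $\mathrm{Circ}(n, \{p, q\})$, $1 \le p < q < \frac{n}{2}$, attaining it are exactly those with $p$ and $q$ both odd and $\gcd(p, q, n) = 1$, and the corresponding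 null spaces are trivial.
   Context: For an integer $n \ge 1$ and a set $S$ of integers $j$ with $1 \le j \le \frac{n}{2}$, $\mathrm{Circ}(n, S)$ denotes the circulant graph with vertex set $\{0, 1, \ldots, n-1\}$ in which two distinct vertices $i, k$ are adjacent if and only if $i - k \equiv s$ or $i - k \equiv -s \pmod n$ for some $s \in S$. The quartic ($4$-regular) circulant graphs of order $n$ are exactly the graphs $\mathrm{Circ}(n, \{p, q\})$ with $n \ge 5$ and $1 \le p < q < \frac{n}{2}$. The null space of a graph is the null space of its adjacency matrix (as a subspace of $\mathbb{R}^n$, coordinates indexed by the vertices $0, 1, \ldots, n-1$ in order), and its nullity is the dimension of this null space. *)

theory Defs
  imports Complex_Main "HOL-Number_Theory.Cong"
    "Graph_Theory.Graph_Theory" "Jordan_Normal_Form.Matrix_Kernel"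
begin

definition circ :: "nat \<Rightarrow> nat set \<Rightarrow> nat pair_pre_digraph" where
  "circ n S = \<lparr> pverts = {0..<n},
     parcs = {(i, k). i \<in> {0..<n} \<and> k \<in> {0..<n} \<and> i \<noteq> k \<and>
       (\<exists>s\<in>S. [int i - int k = int s] (mod int n) \<or>
              [int i - int k = - int s] (mod int n))} \<rparr>"

lemma pair_graph_circ: "pair_graph (circ n S)"
proof unfold_locales
  have "parcs (circ n S) \<subseteq> {0..<n} \<times> {0..<n}"
    by (auto simp: circ_def)
  then show "finite (parcs (circ n S))"
    by (rule finite_subset) auto
  have "(k, i) \<in> parcs (circ n S)" if "(i, k) \<in> parcs (circ n S)" for i k
  proof -
    have "[int k - int i = - x] (mod int n)" if "[int i - int k = x] (mod int n)" for x
      using that cong_minus_minus_iff[of "int i - int k" x "int n"] by simp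
    then show ?thesis
      using that unfolding circ_def by fastforce
  qed
  then show "symmetric (with_proj (circ n S))"
    unfolding symmetric_def by (auto intro: symI)
qed (auto simp: circ_def)

text \<open>Row and column \<open>i\<close> belong to vertex \<open>i\<close>, so the vertices are meant to be
  \<open>0, \<dots>, card (pverts G) - 1\<close>, as they are for \<open>circ n S\<close>.\<close>

definition adjacency_matrix :: "nat pair_pre_digraph \<Rightarrow> real mat" where
  "adjacency_matrix G =
     mat (card (pverts G)) (card (pverts G)) (\<lambda>(i, k). of_bool ((i, k) \<in> parcs G))"

definition null_space :: "nat pair_pre_digraph \<Rightarrow> real vec set" where
  "null_space G = mat_kernel (adjacency_matrix G)"

definition nullity :: "nat pair_pre_digraph \<Rightarrow> nat" where
  "nullity G = kernel_dim (adjacency_matrix G)"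

definition conn_quartic_circulants :: "nat \<Rightarrow> nat pair_pre_digraph set" where
  "conn_quartic_circulants n =
     {circ n {p, q} | p q. 1 \<le> p \<and> p < q \<and> real q < real n / 2 \<and> connected (circ n {p, q})}"

definition min_nullity :: "nat \<Rightarrow> nat" where
  "min_nullity n = Min (nullity ` conn_quartic_circulants n)"

definition attains_min_nullity :: "nat \<Rightarrow> nat pair_pre_digraph \<Rightarrow> bool" where
  "attains_min_nullity n G \<longleftrightarrow> G \<in> conn_quartic_circulants n \<and> nullity G = min_nullity n"

abbreviation real_span :: "nat \<Rightarrow> real vec set \<Rightarrow> real vec set" where
  "real_span n \<equiv> LinearCombinations.module.span class_ring (module_vec TYPE(real) n)"

text \<open>The minimum is taken over a finite nonempty set, so \<open>Min\<close> is meaningful.\<close>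

lemma finite_conn_quartic_circulants: "finite (conn_quartic_circulants n)"
proof (rule finite_subset)
  show "conn_quartic_circulants n \<subseteq> (\<lambda>(p, q). circ n {p, q}) ` ({..n} \<times> {..n})"
    by (force simp: conn_quartic_circulants_def)
qed auto

lemma conn_quartic_circulants_nonempty:
  assumes "n \<ge> 5"
  shows "conn_quartic_circulants n \<noteq> {}"
proof -
  let ?G = "with_proj (circ n {1, 2})"
  interpret pair_graph "circ n {1, 2}" by (rule pair_graph_circ)
  have reach: "0 \<rightarrow>\<^sup>*\<^bsub>?G\<^esub> i" if "i < n" for i
    using that
  proof (induction i)
    case 0
    then show ?case by (intro reachable_refl) (auto simp: circ_def)
  next
    case (Suc i)
    have "(i, Suc i) \<in> parcs (circ n {1, 2})"
      using Suc.prems by (auto simp: circ_def)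
    with Suc show ?case
      using reachable_adj_trans by (meson Suc_lessD)
  qed
  have "u \<rightarrow>\<^sup>*\<^bsub>mk_symmetric ?G\<^esub> v" if "u < n" "v < n" for u v
  proof -
    have "u \<rightarrow>\<^sup>*\<^bsub>?G\<^esub> v"
      using reach that symmetric_reachable[OF sym_arcs] reachable_trans by meson
    then show ?thesis
      by (rule reachable_mk_symmetricI)
  qed
  then have "connected ?G"
    using assms
    by (auto simp: Digraph_Component.connected_def strongly_connected_def circ_def)
  then have "circ n {1, 2} \<in> conn_quartic_circulants n"
    using assms unfolding conn_quartic_circulants_def by fastforce
  then show ?thesis by blast
qed

end

theory Submission
  imports Defs
begin

text \<open>Let \<open>T\<close> be the cyclic shift of \<open>\<real>\<^sup>n\<close> and put \<open>a = p + q\<close>, \<open>b = q - p\<close>. The adjacency operator is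
  \<open>T\<^bsup>p\<^esup> + T\<^bsup>-p\<^esup> + T\<^bsup>q\<^esup> + T\<^bsup>-q\<^esup> = T\<^bsup>-q\<^esup> (T\<^bsup>a\<^esup> + 1) (T\<^bsup>b\<^esup> + 1)\<close>, so no eigenvalues are needed.
  If \<open>f (i + a) = - f i\<close>, then \<open>f (i + k a) = (-1)\<^bsup>k\<^esup> f i\<close>, hence \<open>f = 0\<close> as soon as \<open>n\<close> divides
  \<open>k a\<close> for an odd \<open>k\<close>: take \<open>k = n\<close> for odd \<open>n\<close>, and \<open>k = n / 2\<close> for \<open>n\<close> congruent to 2 modulo 4
  and \<open>p\<close>, \<open>q\<close> odd. If \<open>n\<close> is even and coprime to both \<open>a\<close> and \<open>b\<close>, each factor kills exactly the
  multiples of the alternating vector, and \<open>f (i + b) + f i = c (-1)\<^bsup>i\<^esup>\<close> has a solution on the cycle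
  only for \<open>c = 0\<close>. In the remaining connected cases explicit vectors changing sign under the shift
  by \<open>a\<close> or \<open>b\<close> make the nullity too large.\<close>

section \<open>Vectors as periodic functions on the integers, so that cyclic shifts become
  additions\<close>

definition cyc :: "nat \<Rightarrow> real vec \<Rightarrow> int \<Rightarrow> real" where
  "cyc n v i = v $ nat (i mod int n)"

lemma cyc_nat: "i < n \<Longrightarrow> cyc n v (int i) = v $ i"
  by (simp add: cyc_def)

lemma cyc_cong: "[i = j] (mod int n) \<Longrightarrow> cyc n v i = cyc n v j"
  by (simp add: cyc_def cong_def)

lemma cyc_vec:
  assumes "n > 0" and "\<And>i j. [i = j] (mod int n) \<Longrightarrow> h i = h j"
  shows "cyc n (vec n (\<lambda>k. h (int k))) i = h i"
proof -
  have "cyc n (vec n (\<lambda>k. h (int k))) i = h (i mod int n)"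
    using assms(1) by (simp add: cyc_def nat_less_iff)
  also have "\<dots> = h i"
    by (rule assms(2)) simp
  finally show ?thesis .
qed

lemma cyc_eq_0_imp_zero_vec:
  assumes "v \<in> carrier_vec n" "\<And>i. cyc n v i = 0"
  shows "v = 0\<^sub>v n"
proof (rule eq_vecI)
  show "v $ i = 0\<^sub>v n $ i" if "i < dim_vec (0\<^sub>v n :: real vec)" for i
    using that cyc_nat[of i n v] assms(2) by simp
qed (use assms(1) in simp)

section \<open>Functions changing sign under a shift\<close>

lemma antiperiodic_power:
  fixes f :: "int \<Rightarrow> real"
  assumes "\<And>i. f (i + a) = - f i"
  shows "f (i + int k * a) = (-1) ^ k * f i"
proof (induction k)
  case (Suc k)
  have "f (i + int (Suc k) * a) = f (i + int k * a + a)"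
    by (simp add: algebra_simps)
  with Suc assms show ?case by simp
qed simp

text \<open>Shifting k times by a multiplies f by -1, as k is odd, but is also a shift by a multiple
  of the period and so fixes f.\<close>

lemma antiperiodic_imp_zero:
  fixes f :: "int \<Rightarrow> real"
  assumes "\<And>i. f (i + a) = - f i" and "\<And>i j. [i = j] (mod m) \<Longrightarrow> f i = f j"
    and "odd k" "m dvd int k * a"
  shows "f i = 0"
proof -
  have "f (i + int k * a) = f i"
    using assms(4) by (intro assms(2)) (simp add: cong_iff_dvd_diff)
  with antiperiodic_power[of f a i k] assms(1,3) show ?thesis by simp
qed

text \<open>Let k be an inverse of a modulo n. Since n is even, k is odd, so k shifts by a amount to
  one shift by 1 and change the sign an odd number of times.\<close>

lemma antiperiodic_coprime:
  fixes f :: "int \<Rightarrow> real"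
  assumes "\<And>i. f (i + int a) = - f i" and "\<And>i j. [i = j] (mod int n) \<Longrightarrow> f i = f j"
    and "even n" "gcd n a = 1"
  shows "f (i + 1) = - f i"
proof -
  obtain k where k: "[a * k = 1] (mod n)"
    using cong_solve_coprime_nat[of a n] assms(4) by (auto simp: coprime_iff_gcd_eq_1 gcd.commute)
  then have "[a * k = 1] (mod 2)"
    using assms(3) by (rule cong_dvd_modulus_nat)
  then have "odd k" by (auto simp: cong_def)
  have "[int k * int a = 1] (mod int n)"
    using k by (metis cong_int_iff mult.commute of_nat_1 of_nat_mult)
  then have "f (i + 1) = f (i + int k * int a)"
    by (intro assms(2) cong_add) (auto simp: cong_sym)
  with antiperiodic_power[of f "int a" i k] assms(1) \<open>odd k\<close> show ?thesis by simp
qed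

section \<open>Kernels read off from pivot coordinates\<close>

text \<open>At its pivot a vector of B is 1 and all the others are 0, so a linear combination shows
  its coefficients at the pivots; this gives independence. For the span, subtract from v the
  combination with coefficients \<open>v $ pivot b\<close>: the difference vanishes at every pivot,
  hence is zero by the extra hypothesis.\<close>

lemma
  fixes A :: "real mat"
  assumes A: "A \<in> carrier_mat m n" and B: "finite B" "B \<subseteq> mat_kernel A"
    and piv: "\<And>b. b \<in> B \<Longrightarrow> pivot b < n"
      "\<And>b c. b \<in> B \<Longrightarrow> c \<in> B \<Longrightarrow> c $ pivot b = of_bool (c = b)"
  shows card_le_kernel_dim: "card B \<le> kernel_dim A"
    and mat_kernel_eq_span: "(\<And>v. v \<in> mat_kernel A \<Longrightarrow> (\<And>b. b \<in> B \<Longrightarrow> v $ pivot b = 0) \<Longrightarrow> v = 0\<^sub>v n)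
      \<Longrightarrow> mat_kernel A = real_span n B \<and> kernel_dim A = card B"
proof -
  interpret kernel m n A by unfold_locales (rule A)
  have coord: "lincomb a B $ pivot b = a b" if "b \<in> B" for a b
  proof -
    have "lincomb a B $ pivot b = (\<Sum>c\<in>B. a c * of_bool (c = b))"
      unfolding lincomb_index[OF piv(1)[OF that] B(2)] using piv(2)[OF that]
      by (intro sum.cong) auto
    then show ?thesis
      using that B(1) by (simp add: of_bool_def if_distrib sum.delta cong: if_cong)
  qed
  have li: "lin_indpt B"
  proof (rule Ker.finite_lin_indpt2)
    show "\<forall>v\<in>B. a v = 0" if "lincomb a B = 0\<^sub>v n" for a
      using coord[of _ a] piv(1) that by auto
  qed (use B in auto)
  have fd: "Ker.fin_dim"
    using kernel_basis_exists[OF A] unfolding Ker.fin_dim_def Ker.basis_def by blast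
  show "card B \<le> kernel_dim A"
    using Ker.li_le_dim(2)[OF fd B(2) li] by simp
  assume *: "\<And>v. v \<in> mat_kernel A \<Longrightarrow> (\<And>b. b \<in> B \<Longrightarrow> v $ pivot b = 0) \<Longrightarrow> v = 0\<^sub>v n"
  have "v \<in> span B" if v: "v \<in> mat_kernel A" for v
  proof -
    define w where "w = lincomb (\<lambda>b. v $ pivot b) B"
    have w: "w \<in> span B" "w \<in> mat_kernel A"
      using Ker.finite_span[OF B] Ker.lincomb_closed[OF B(2)] by (auto simp: w_def)
    have car: "v \<in> carrier_vec n" "w \<in> carrier_vec n"
      using v w(2) mat_kernel_carrier[OF A] by auto
    have "v - w \<in> mat_kernel A"
      using mat_kernelD[OF A v] mat_kernelD[OF A w(2)] A car
      by (intro mat_kernelI[OF A]) (auto simp: mult_minus_distrib_mat_vec)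
    moreover have "(v - w) $ pivot b = 0" if "b \<in> B" for b
      using coord[OF that] piv(1)[OF that] car by (simp add: w_def)
    ultimately have "v - w = 0\<^sub>v n" by (rule *)
    have "v = w"
    proof (rule eq_vecI)
      show "v $ i = w $ i" if "i < dim_vec w" for i
        using arg_cong[OF \<open>v - w = 0\<^sub>v n\<close>, of "\<lambda>u. u $ i"] that car by simp
    qed (use car in simp)
    with w show ?thesis by simp
  qed
  then have gen: "span B = mat_kernel A"
    using Ker.span_is_subset2[OF B(2)] by auto
  then have "basis B"
    unfolding Ker.basis_def using li B(2) by auto
  \<comment> \<open>Here \<open>span\<close> is formed inside the kernel as a vector space of its
    own; \<open>span_same\<close> identifies it with the span in the ambient space.\<close>
  with gen show "mat_kernel A = real_span n B \<and> kernel_dim A = card B"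
    using span_same[OF B(2)] Ker.dim_basis[OF B(1)] by simp
qed

section \<open>The adjacency matrix as a sum of four cyclic shifts\<close>

lemma circ_edge_iff:
  assumes "i < n" "k < n"
  shows "(i, k) \<in> parcs (circ n {p, q}) \<longleftrightarrow>
    i \<noteq> k \<and> (\<exists>s\<in>{int p, - int p, int q, - int q}. [int k = int i + s] (mod int n))"
proof -
  have "[int i - int k = s] (mod int n) \<longleftrightarrow> [int k = int i + - s] (mod int n)" for s
    using dvd_minus_iff[of "int n" "int i - int k - s"]
    by (simp add: cong_iff_dvd_diff algebra_simps)
  then show ?thesis
    using assms by (auto simp: circ_def)
qed

locale quartic_circ =
  fixes n p q :: nat
  assumes p_pos: "1 \<le> p" and p_less_q: "p < q" and q_less: "2 * q < n"
begin

abbreviation "G \<equiv> circ n {p, q}"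

lemma n_pos: "n > 0"
  using q_less by simp

lemma adjacency_matrix_carrier: "adjacency_matrix G \<in> carrier_mat n n"
  by (simp add: adjacency_matrix_def circ_def)

text \<open>The jumps p, -p, q, -q differ from one another by at most 2q < n, so they stay distinct
  modulo n and lead from i to four different neighbours.\<close>

lemma adjacency_matrix_mult:
  assumes "v \<in> carrier_vec n" "i < n"
  shows "(adjacency_matrix G *\<^sub>v v) $ i =
    cyc n v (int i + int p) + cyc n v (int i - int p) + cyc n v (int i + int q) + cyc n v (int i - int q)"
proof -
  let ?S = "{int p, - int p, int q, - int q}"
  let ?nb = "\<lambda>s. nat ((int i + s) mod int n)"
  have inj: "inj_on ?nb ?S"
  proof (rule inj_onI)
    fix s t assume st: "s \<in> ?S" "t \<in> ?S" "?nb s = ?nb t"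
    then have "[int i + s = int i + t] (mod int n)"
      using n_pos by (simp add: cong_def eq_nat_nat_iff)
    then have "int n dvd s - t"
      by (simp add: cong_iff_dvd_diff)
    moreover have "\<bar>s - t\<bar> < int n"
      using st(1,2) p_less_q q_less by auto
    ultimately show "s = t"
      using zdvd_imp_le[of "int n" "\<bar>s - t\<bar>"] by fastforce
  qed
  have nb: "{k \<in> {0..<n}. (i, k) \<in> parcs G} = ?nb ` ?S"
  proof (intro equalityI subsetI)
    fix k assume "k \<in> {k \<in> {0..<n}. (i, k) \<in> parcs G}"
    then have "k < n" "\<exists>s\<in>?S. [int k = int i + s] (mod int n)"
      using assms(2) circ_edge_iff[of i n k p q] by simp_all
    then obtain s where "k < n" "s \<in> ?S" "[int k = int i + s] (mod int n)"
      by blast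
    then have "k = ?nb s"
      by (metis cong_def mod_less nat_int zmod_int)
    with \<open>s \<in> ?S\<close> show "k \<in> ?nb ` ?S" by blast
  next
    fix k assume "k \<in> ?nb ` ?S"
    then obtain s where s: "s \<in> ?S" "k = ?nb s" by blast
    have k: "k < n" "[int k = int i + s] (mod int n)"
      using n_pos s(2) by (auto simp: nat_less_iff cong_def)
    \<comment> \<open>No jump is a multiple of n, so the exclusion of loops removes none of the four
      neighbours.\<close>
    have "i \<noteq> k"
    proof
      assume "i = k"
      with k(2) have "int n dvd s"
        by (simp add: cong_iff_dvd_diff)
      moreover have "\<bar>s\<bar> < int n" "s \<noteq> 0"
        using s(1) p_pos p_less_q q_less by auto
      ultimately show False
        using zdvd_imp_le[of "int n" "\<bar>s\<bar>"] by fastforce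
    qed
    with k s(1) show "k \<in> {k \<in> {0..<n}. (i, k) \<in> parcs G}"
      using assms(2) circ_edge_iff[of i n k p q] by auto
  qed
  have "(adjacency_matrix G *\<^sub>v v) $ i = (\<Sum>k\<in>{0..<n}. of_bool ((i, k) \<in> parcs G) * v $ k)"
    using assms by (simp add: adjacency_matrix_def circ_def scalar_prod_def)
  also have "\<dots> = (\<Sum>k\<in>{k \<in> {0..<n}. (i, k) \<in> parcs G}. v $ k)"
    by (intro sum.mono_neutral_cong_right) auto
  also have "\<dots> = (\<Sum>s\<in>?S. cyc n v (int i + s))"
    unfolding nb by (subst sum.reindex[OF inj]) (simp add: cyc_def)
  also have "\<dots> = cyc n v (int i + int p) + cyc n v (int i - int p) + cyc n v (int i + int q) + cyc n v (int i - int q)"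
    using p_pos p_less_q by simp
  finally show ?thesis .
qed

text \<open>The row equation is read at i + q instead of i, which is harmless once i runs over all
  integers. As 2q = (p + q) + (q - p), it becomes the product of the two factors shift by p + q plus
  1 and shift by q - p plus 1, multiplied out.\<close>

lemma null_space_iff:
  "v \<in> null_space G \<longleftrightarrow> v \<in> carrier_vec n \<and>
    (\<forall>i. cyc n v (i + int (p + q) + int (q - p)) + cyc n v (i + int (p + q))
       + cyc n v (i + int (q - p)) + cyc n v i = 0)"
proof (cases "v \<in> carrier_vec n")
  case True
  let ?r = "\<lambda>i. cyc n v (i + int p) + cyc n v (i - int p) + cyc n v (i + int q) + cyc n v (i - int q)"
  have "v \<in> null_space G \<longleftrightarrow> (\<forall>i<n. (adjacency_matrix G *\<^sub>v v) $ i = 0)"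
    using True adjacency_matrix_carrier
    by (auto simp: null_space_def mat_kernel[OF adjacency_matrix_carrier] vec_eq_iff
        simp del: index_mult_mat_vec)
  also have "\<dots> \<longleftrightarrow> (\<forall>i<n. ?r (int i) = 0)"
    using adjacency_matrix_mult[OF True] by simp
  also have "\<dots> \<longleftrightarrow> (\<forall>i. ?r i = 0)"
  proof safe
    fix i assume *: "\<forall>i<n. ?r (int i) = 0"
    have "?r i = ?r (i mod int n)"
      by (intro arg_cong2[where f = "(+)"] cyc_cong) (simp_all add: cong_def mod_simps)
    also have "\<dots> = 0"
      using *[rule_format, of "nat (i mod int n)"] n_pos by (simp add: nat_less_iff)
    finally show "?r i = 0" .
  qed simp
  also have "\<dots> \<longleftrightarrow> (\<forall>i. ?r (i + int q) = 0)"
    by (metis diff_add_cancel)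
  finally show ?thesis
    using True p_less_q by (simp add: of_nat_diff algebra_simps)
next
  case False
  then show ?thesis
    using mat_kernel_carrier[OF adjacency_matrix_carrier] by (auto simp: null_space_def)
qed

section \<open>Connectedness\<close>

text \<open>Arcs preserve residues modulo g = gcd(p, q, n), so vertex 1 is reachable from 0 only if
  g = 1. Conversely, Bezout coefficients tell how many jumps by p and by q lead from one vertex to
  another.\<close>

lemma connected_iff: "connected G \<longleftrightarrow> gcd p (gcd q n) = 1"
proof -
  interpret pair_graph G by (rule pair_graph_circ)
  have conn: "connected G \<longleftrightarrow> (\<forall>u<n. \<forall>v<n. u \<rightarrow>\<^sup>*\<^bsub>G\<^esub> v)"
    using n_pos unfolding Digraph_Component.connected_def strongly_connected_def
      reachable_mk_symmetric_eq[OF sym_arcs]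
    by (auto simp: circ_def)
  show ?thesis
  proof
    assume c: "connected G"
    define g where "g = gcd p (gcd q n)"
    have reach_0: "[int v = 0] (mod int g)" if "0 \<rightarrow>\<^sup>*\<^bsub>G\<^esub> v" for v
      using that
    proof (induction rule: reachable_induct)
      case (step x y)
      then have "(x, y) \<in> parcs G"
        by simp
      then have "x < n" "y < n" "(x, y) \<in> parcs G"
        by (simp_all add: circ_def)
      then have "\<exists>s\<in>{int p, - int p, int q, - int q}. [int y = int x + s] (mod int n)"
        by (simp only: circ_edge_iff)
      then obtain s where s: "s \<in> {int p, - int p, int q, - int q}" "[int y = int x + s] (mod int n)"
        by blast
      have "g dvd p" "g dvd q" "g dvd n"
        unfolding g_def by (meson gcd_dvd1 gcd_dvd2 dvd_trans)+
      then have "int g dvd s" "int g dvd int n"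
        using s(1) by auto
      moreover have "[int y = int x + s] (mod int g)"
        using s(2) \<open>int g dvd int n\<close> by (rule cong_dvd_modulus)
      moreover have "[int x + s = 0 + 0] (mod int g)"
        using step.IH \<open>int g dvd s\<close> by (intro cong_add) (simp_all add: cong_0_iff)
      ultimately show ?case
        by (metis add_0 cong_trans)
    qed simp
    have "[int 1 = 0] (mod int g)"
      by (rule reach_0) (use c conn p_less_q q_less in auto)
    then show "gcd p (gcd q n) = 1"
      by (simp add: g_def cong_0_iff)
  next
    assume g: "gcd p (gcd q n) = 1"
    \<comment> \<open>Reachability is lifted to integers modulo n, so that walks can be described by
      integer arithmetic without wrapping around.\<close>
    define R where "R i j \<longleftrightarrow> nat (i mod int n) \<rightarrow>\<^sup>*\<^bsub>G\<^esub> nat (j mod int n)" for i j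
    have R_refl: "R i j" if "[i = j] (mod int n)" for i j
      unfolding R_def that[unfolded cong_def]
      by (rule reachable_refl) (use n_pos in \<open>simp add: circ_def nat_less_iff\<close>)
    have R_trans: "R i j \<Longrightarrow> R j k \<Longrightarrow> R i k" for i j k
      unfolding R_def by (rule reachable_trans)
    have R_step: "R i (i + s)" if "s \<in> {int p, - int p, int q, - int q}" for i s
    proof (cases "[i = i + s] (mod int n)")
      case False
      let ?u = "nat (i mod int n)" and ?v = "nat ((i + s) mod int n)"
      have "?u < n" "?v < n" using n_pos by (auto simp: nat_less_iff)
      moreover have "?u \<noteq> ?v"
        using False n_pos by (auto simp: cong_def eq_nat_nat_iff)
      moreover have "[int ?v = int ?u + s] (mod int n)"
        using n_pos by (simp add: cong_def mod_simps)
      ultimately have "(?u, ?v) \<in> parcs G"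
        using that by (simp only: circ_edge_iff) blast
      then show ?thesis unfolding R_def by (intro reachable_adjI) simp
    qed (rule R_refl)
    have R_mult: "R i (i + int k * s)" if "s \<in> {int p, - int p, int q, - int q}" for i k s
    proof (induction k)
      case (Suc k)
      have "i + int (Suc k) * s = i + int k * s + s"
        by (simp add: algebra_simps)
      with Suc R_step[OF that, of "i + int k * s"] show ?case
        using R_trans by metis
    qed (simp add: R_refl)
    have R_int: "R i (i + z * s)" if "s \<in> {int p, int q}" for i z s
    proof (cases "z \<ge> 0")
      case True
      then show ?thesis using R_mult[of s i "nat z"] that by auto
    next
      case False
      then show ?thesis using R_mult[of "- s" i "nat (- z)"] that by auto
    qed
    obtain x y where xy: "x * int p + y * gcd (int q) (int n) = gcd (int p) (gcd (int q) (int n))"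
      using bezout_int by blast
    obtain z w where zw: "z * int q + w * int n = gcd (int q) (int n)"
      using bezout_int by blast
    have one: "x * int p + y * z * int q + y * w * int n = 1"
    proof -
      have "gcd (int p) (gcd (int q) (int n)) = 1"
        using g by (simp add: gcd_int_int_eq)
      then show ?thesis
        using xy unfolding zw[symmetric] by (simp add: algebra_simps)
    qed
    have "R i j" for i j
    proof -
      \<comment> \<open>Scaling the Bezout identity \<open>one\<close> by j - i gives the number of
        jumps of each kind; the multiple of n disappears modulo n.\<close>
      let ?d = "j - i"
      have "R i (i + (?d * x) * int p + (?d * y * z) * int q)"
        using R_trans[OF R_int R_int] by simp
      moreover have "[i + (?d * x) * int p + (?d * y * z) * int q = j] (mod int n)"
      proof -
        have "i + (?d * x) * int p + (?d * y * z) * int q = j - ?d * y * w * int n"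
          using arg_cong[OF one, of "\<lambda>t. ?d * t"] by (simp add: algebra_simps)
        then show ?thesis by (simp add: cong_iff_dvd_diff)
      qed
      ultimately show ?thesis using R_refl R_trans by blast
    qed
    then have "u \<rightarrow>\<^sup>*\<^bsub>G\<^esub> v" if "u < n" "v < n" for u v
      using that unfolding R_def by (metis mod_less nat_int zmod_int)
    then show "connected G"
      unfolding conn by blast
  qed
qed

lemma mem_if_connected: "connected G \<Longrightarrow> G \<in> conn_quartic_circulants n"
  using p_pos p_less_q q_less unfolding conn_quartic_circulants_def by fastforce

lemma attains_iff: "attains_min_nullity n G \<longleftrightarrow> gcd p (gcd q n) = 1 \<and> nullity G = min_nullity n"
proof -
  have "G \<in> conn_quartic_circulants n \<longleftrightarrow> connected G"
    using mem_if_connected by (auto simp: conn_quartic_circulants_def)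
  then show ?thesis
    by (simp add: attains_min_nullity_def connected_iff)
qed

section \<open>Trivial null spaces\<close>

text \<open>The two factors are removed one after the other. The function g, the first factor
  applied to f, changes sign under the shift by q - p, so it is zero; then f changes sign under the
  shift by p + q, so it is zero too.\<close>

lemma null_space_trivial:
  assumes "odd k" "n dvd k * (p + q)" "n dvd k * (q - p)"
  shows "null_space G = {0\<^sub>v n} \<and> nullity G = 0"
proof -
  have *: "v = 0\<^sub>v n" if v: "v \<in> null_space G" for v
  proof (rule cyc_eq_0_imp_zero_vec)
    let ?f = "cyc n v"
    define g where "g = (\<lambda>i. ?f (i + int (p + q)) + ?f i)"
    have "g (i + int (q - p)) = - g i" for i
      using v[unfolded null_space_iff, THEN conjunct2, rule_format, of i]
      by (simp add: g_def algebra_simps)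
    moreover have "g i = g j" if "[i = j] (mod int n)" for i j
      unfolding g_def using that by (intro arg_cong2[where f = "(+)"] cyc_cong cong_add) auto
    moreover have "int n dvd int k * int (q - p)"
      using assms(3) by (metis of_nat_dvd_iff of_nat_mult)
    ultimately have "g i = 0" for i
      using antiperiodic_imp_zero[of g _ "int n" k i] assms(1) by blast
    then have "?f (i + int (p + q)) = - ?f i" for i
      unfolding g_def by (metis add_eq_0_iff2)
    moreover have "int n dvd int k * int (p + q)"
      using assms(2) by (metis of_nat_dvd_iff of_nat_mult)
    ultimately show "?f i = 0" for i
      using antiperiodic_imp_zero[of ?f _ "int n" k i] assms(1) cyc_cong by blast
  qed (use v null_space_iff in blast)
  \<comment> \<open>With the empty set as basis the pivot conditions are vacuous, and the dimension
    comes out as 0.\<close>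
  have "mat_kernel (adjacency_matrix G) = real_span n {} \<and> kernel_dim (adjacency_matrix G) = card ({} :: real vec set)"
  proof (rule mat_kernel_eq_span[OF adjacency_matrix_carrier])
    show "v = 0\<^sub>v n" if "v \<in> mat_kernel (adjacency_matrix G)" for v
      using that by (intro *) (simp add: null_space_def)
  qed auto
  moreover have "0\<^sub>v n \<in> null_space G"
    using n_pos by (simp add: null_space_iff cyc_def nat_less_iff)
  ultimately show ?thesis
    using * unfolding nullity_def card.empty by blast
qed

section \<open>Configurations forcing nullity at least 2\<close>

text \<open>If h changes sign under one of the two shifts, the four terms of the null space equation
  cancel in pairs.\<close>

lemma vec_in_null_space:
  fixes h :: "int \<Rightarrow> real"
  assumes "c \<in> {p + q, q - p}" "\<And>i j. [i = j] (mod int n) \<Longrightarrow> h i = h j"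
    and "\<And>i. h (i + int c) = - h i"
  shows "vec n (\<lambda>k. h (int k)) \<in> null_space G"
proof -
  have "h (i + int (p + q) + int (q - p)) + h (i + int (p + q)) + h (i + int (q - p)) + h i = 0" for i
    using assms(1) assms(3)[of i] assms(3)[of "i + int (p + q)"] assms(3)[of "i + int (q - p)"]
    by (auto simp: add_ac)
  moreover have "cyc n (vec n (\<lambda>k. h (int k))) i = h i" for i
    using n_pos assms(2) by (rule cyc_vec)
  ultimately show ?thesis
    by (simp only: null_space_iff vec_carrier simp_thms)
qed

text \<open>The prescribed values make vertices 0 and 1 pivots for the two vectors.\<close>

lemma two_le_nullity:
  fixes h1 h2 :: "int \<Rightarrow> real"
  assumes "c \<in> {p + q, q - p}"
    and "\<And>i j. [i = j] (mod int n) \<Longrightarrow> h1 i = h1 j" "\<And>i. h1 (i + int c) = - h1 i"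
    and "\<And>i j. [i = j] (mod int n) \<Longrightarrow> h2 i = h2 j" "\<And>i. h2 (i + int c) = - h2 i"
    and "h1 0 = 1" "h1 1 = 0" "h2 0 = 0" "h2 1 = 1"
  shows "2 \<le> nullity G"
proof -
  let ?v1 = "vec n (\<lambda>k. h1 (int k))" and ?v2 = "vec n (\<lambda>k. h2 (int k))"
  have n: "1 < n" using p_less_q q_less by simp
  have neq: "?v1 \<noteq> ?v2"
  proof
    assume "?v1 = ?v2"
    then have "?v1 $ 0 = ?v2 $ 0" by (rule arg_cong)
    with n assms(6,8) show False by simp
  qed
  have "card {?v1, ?v2} \<le> kernel_dim (adjacency_matrix G)"
  proof (rule card_le_kernel_dim[OF adjacency_matrix_carrier, where pivot = "\<lambda>b. if b = ?v1 then 0 else 1"])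
    have "?v1 \<in> null_space G" "?v2 \<in> null_space G"
      by (rule vec_in_null_space[of c]; use assms(1-5) in blast)+
    then show "{?v1, ?v2} \<subseteq> mat_kernel (adjacency_matrix G)"
      by (simp add: null_space_def)
  qed (use n neq assms(6-9) in auto)
  with neq show ?thesis by (simp add: nullity_def)
qed

text \<open>Take a common divisor d of n and c other than 1. The alternating function splits into
  its parts on and off the multiples of d. Both are n-periodic, as n is even and d divides n, and
  change sign under the shift by c, as c is odd and d divides c. Since d does not divide 1, they are
  told apart at 0 and 1.\<close>

lemma two_le_nullity_if_common_factor:
  assumes "even n" "c \<in> {p + q, q - p}" "odd c" "gcd n c \<noteq> 1"
  shows "2 \<le> nullity G"
proof -
  obtain d where d_dvd: "d dvd n" "d dvd c" "d \<noteq> 1"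
    using assms(4) by (meson gcd_dvd1 gcd_dvd2)
  let ?d = "int d"
  let ?e = "\<lambda>i::int. if even i then 1 else - 1 :: real"
  have d: "\<not> ?d dvd 1" "?d dvd int n" "?d dvd int c"
    using d_dvd by auto
  have 1: "(?d dvd i \<longleftrightarrow> ?d dvd j) \<and> (even i \<longleftrightarrow> even j)" if "[i = j] (mod int n)" for i j
  proof -
    have "?d dvd i - j" "even (i - j)"
      using that assms(1) d(2) unfolding cong_iff_dvd_diff
      by (meson dvd_trans even_of_nat of_nat_dvd_iff)+
    then show ?thesis
      by (metis dvd_diff_right_iff dvd_diff_left_iff diff_add_cancel dvd_add_right_iff even_add)
  qed
  have 2: "?d dvd i + int c \<longleftrightarrow> ?d dvd i" for i
    using d(3) by (rule dvd_add_left_iff)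
  show ?thesis
    \<comment> \<open>The minus sign in the second function normalises its value at 1, where the
      alternating function is -1.\<close>
    by (rule two_le_nullity[OF assms(2), of "\<lambda>i. if ?d dvd i then ?e i else 0"
            "\<lambda>i. if ?d dvd i then 0 else - ?e i"])
      (use 1 2 d(1) assms(3) in auto)
qed

text \<open>The even numbers p + q and q - p add up to 2q, which is 2 modulo 4, so one of them is 2
  modulo 4. The pattern 1, 0, -1, 0 of period 4 and its translate by 1 change sign under that
  shift.\<close>

lemma two_le_nullity_if_both_odd:
  assumes "4 dvd n" "odd p" "odd q"
  shows "2 \<le> nullity G"
proof -
  let ?h = "\<lambda>i::int. if i mod 4 = 0 then 1 else if i mod 4 = 2 then - 1 else 0 :: real"
  obtain m where m: "q = p + 2 * m"
    using assms(2,3) p_less_q by (metis even_diff_nat evenE le_add_diff_inverse less_imp_le_nat odd_even_add)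
  obtain x where x: "p = 2 * x + 1"
    using assms(2) by (rule oddE)
  have "(p + q) mod 4 = 2 \<or> (q - p) mod 4 = 2"
    unfolding m x by simp presburger
  then obtain c where c: "c \<in> {p + q, q - p}" "c mod 4 = 2" by blast
  have 1: "i mod 4 = j mod 4" if "[i = j] (mod int n)" for i j
    using that assms(1) cong_dvd_modulus[of i j "int n" 4]
    by (metis cong_def of_nat_dvd_iff of_nat_numeral)
  have 2: "?h (i + int c) = - ?h i" for i
  proof -
    have "(i + int c) mod 4 = 0 \<longleftrightarrow> i mod 4 = 2" "(i + int c) mod 4 = 2 \<longleftrightarrow> i mod 4 = 0"
      using c(2) by presburger+
    then show ?thesis by auto
  qed
  show ?thesis
  proof (rule two_le_nullity[OF c(1), of ?h "\<lambda>i. ?h (i - 1)"])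
    show "?h i = ?h j" if "[i = j] (mod int n)" for i j
      using 1[OF that] by simp
    show "?h (i - 1) = ?h (j - 1)" if "[i = j] (mod int n)" for i j
      using 1[of "i - 1" "j - 1"] that by (simp add: cong_diff)
    show "?h (i + int c - 1) = - ?h (i - 1)" for i
      using 2[of "i - 1"] unfolding diff_add_eq .
  qed (use 2 in auto)
qed

section \<open>The alternating vector\<close>

lemma alternating_in_null_space:
  assumes "even n" "odd (p + q)"
  shows "vec n (\<lambda>i. (-1) ^ i) \<in> null_space G"
proof -
  have "vec n (\<lambda>k. if even (int k) then 1 else - 1 :: real) \<in> null_space G"
  proof (rule vec_in_null_space[of "p + q"])
    show "(if even i then 1 else - 1 :: real) = (if even j then 1 else - 1)"
      if "[i = j] (mod int n)" for i j
    proof -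
      have "even (i - j)"
        using that assms(1) unfolding cong_iff_dvd_diff by (meson dvd_trans even_of_nat)
      then show ?thesis by simp
    qed
  qed (use assms(2) in auto)
  also have "vec n (\<lambda>k. if even (int k) then 1 else - 1 :: real) = vec n (\<lambda>i. (-1) ^ i)"
    by (intro eq_vecI) auto
  finally show ?thesis .
qed

lemma one_le_nullity:
  assumes "even n" "odd (p + q)"
  shows "1 \<le> nullity G"
proof -
  have "card {vec n (\<lambda>i. (-1) ^ i) :: real vec} \<le> kernel_dim (adjacency_matrix G)"
    by (rule card_le_kernel_dim[OF adjacency_matrix_carrier, where pivot = "\<lambda>_. 0"])
      (use alternating_in_null_space[OF assms] n_pos in \<open>auto simp: null_space_def\<close>)
  then show ?thesis by (simp add: nullity_def)
qed

text \<open>Put g(i) = f(i + b) + f(i) with b = q - p. Coprimality of n and p + q makes g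
  alternating. A nonzero g would make f drift by a fixed amount along steps of 2b, which is
  impossible on a cycle. So g = 0, and coprimality of n and b makes f alternating as well, hence
  determined by its value at 0.\<close>

lemma null_space_alternating:
  assumes "even n" "gcd n (p + q) = 1" "gcd n (q - p) = 1"
  shows "null_space G = real_span n {vec n (\<lambda>i. (-1) ^ i)} \<and> nullity G = 1"
proof -
  have odd: "odd (p + q)" "odd (q - p)"
    using assms by (metis gcd_greatest odd_one)+
  have zero: "v = 0\<^sub>v n" if v: "v \<in> null_space G" "v $ 0 = 0" for v
  proof (rule cyc_eq_0_imp_zero_vec)
    let ?f = "cyc n v" and ?b = "int (q - p)"
    define g where "g = (\<lambda>i. ?f (i + ?b) + ?f i)"
    have g_anti: "g (i + int (p + q)) = - g i" for i
      using v(1)[unfolded null_space_iff, THEN conjunct2, rule_format, of i]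
      by (simp add: g_def algebra_simps)
    have g_per: "g i = g j" if "[i = j] (mod int n)" for i j
      unfolding g_def using that by (intro arg_cong2[where f = "(+)"] cyc_cong cong_add) auto
    have g_alt: "g (i + 1) = - g i" for i
      by (rule antiperiodic_coprime[of g "p + q" n, OF g_anti g_per assms(1,2)])
    then have g_b: "g (i + ?b) = - g i" for i
      using antiperiodic_power[of g 1 i "q - p"] odd(2) by simp
    \<comment> \<open>Two steps by b change f by -2 g(i), and g has the same value after them
      because b is odd; the change therefore accumulates linearly.\<close>
    have "?f (i + int k * (2 * ?b)) = ?f i - 2 * real k * g i" for i k
    proof (induction k arbitrary: i)
      case (Suc k)
      have "?f (i + int (Suc k) * (2 * ?b)) = ?f (i + ?b + ?b + int k * (2 * ?b))"
        by (simp add: algebra_simps)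
      also have "\<dots> = ?f (i + ?b + ?b) - 2 * real k * g i"
        using Suc g_b[of i] g_b[of "i + ?b"] by simp
      also have "?f (i + ?b + ?b) = ?f i - 2 * g i"
        using g_b[of i] by (simp add: g_def)
      finally show ?case by (simp add: algebra_simps)
    qed simp
    \<comment> \<open>After n double steps f is back at its starting value, so 2 n g(i) = 0.\<close>
    from this[of _ n] have "g i = 0" for i
      using cyc_cong[of "i + int n * (2 * ?b)" i n v] n_pos by (simp add: cong_iff_dvd_diff)
    then have f_anti: "?f (i + ?b) = - ?f i" for i
      unfolding g_def by (metis add_eq_0_iff2)
    have f_alt: "?f (i + 1) = - ?f i" for i
      by (rule antiperiodic_coprime[of ?f "q - p" n, OF f_anti cyc_cong assms(1,3)])
    have "?f (int k) = 0" for k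
      using antiperiodic_power[of ?f 1 0 k] f_alt v(2) by (simp add: cyc_def)
    from this[of "nat (i mod int n)" for i] show "?f i = 0" for i
      using n_pos by (metis cyc_cong cong_mod_left cong_refl nat_0_le of_nat_0_less_iff pos_mod_sign)
  qed (use v null_space_iff in blast)
  let ?B = "{vec n (\<lambda>i. (-1) ^ i) :: real vec}"
  have "mat_kernel (adjacency_matrix G) = real_span n ?B \<and> kernel_dim (adjacency_matrix G) = card ?B"
  proof (rule mat_kernel_eq_span[OF adjacency_matrix_carrier, where pivot = "\<lambda>_. 0"])
    show "v = 0\<^sub>v n" if "v \<in> mat_kernel (adjacency_matrix G)" "\<And>b. b \<in> ?B \<Longrightarrow> v $ 0 = 0" for v
      using zero[of v] that by (simp add: null_space_def)
  qed (use alternating_in_null_space[OF assms(1) odd(1)] n_pos in \<open>auto simp: null_space_def\<close>)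
  then show ?thesis by (simp add: null_space_def nullity_def)
qed

end

section \<open>The minimum nullity for each class of orders\<close>

lemma min_nullity_eqI:
  assumes "\<And>p q. quartic_circ n p q \<Longrightarrow> gcd p (gcd q n) = 1 \<Longrightarrow> m \<le> nullity (circ n {p, q})"
    and "quartic_circ n p q" "gcd p (gcd q n) = 1" "nullity (circ n {p, q}) = m"
  shows "min_nullity n = m"
  unfolding min_nullity_def
proof (rule Min_eqI)
  show "finite (nullity ` conn_quartic_circulants n)"
    using finite_conn_quartic_circulants by blast
  show "m \<in> nullity ` conn_quartic_circulants n"
    using quartic_circ.mem_if_connected[OF assms(2)] quartic_circ.connected_iff[OF assms(2)]
      assms(3,4) by blast
  fix y assume "y \<in> nullity ` conn_quartic_circulants n"
  then obtain p q where pq: "1 \<le> p" "p < q" "real q < real n / 2" "connected (circ n {p, q})"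
    "y = nullity (circ n {p, q})"
    unfolding conn_quartic_circulants_def by blast
  then have "quartic_circ n p q" by unfold_locales auto
  with pq assms(1) show "m \<le> y"
    using quartic_circ.connected_iff by blast
qed

text \<open>In this graph i is adjacent to every other vertex except i + 3, so opposite vertices
  have the same neighbours and the difference of their unit vectors lies in the null space. Vertices
  0, 1, 2 serve as pivots.\<close>

lemma octahedron_null_space:
  "null_space (circ 6 {1, 2}) =
     real_span 6 {vec_of_list [1, 0, 0, -1, 0, 0],
                  vec_of_list [0, 1, 0, 0, -1, 0],
                  vec_of_list [0, 0, 1, 0, 0, -1]}"
  "nullity (circ 6 {1, 2}) = 3"
proof -
  interpret quartic_circ 6 1 2 by unfold_locales auto
  let ?x = "vec_of_list [1, 0, 0, -1, 0, 0] :: real vec"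
    and ?y = "vec_of_list [0, 1, 0, 0, -1, 0] :: real vec"
    and ?z = "vec_of_list [0, 0, 1, 0, 0, -1] :: real vec"
  let ?B = "{?x, ?y, ?z}"
  have neq: "?x \<noteq> ?y" "?x \<noteq> ?z" "?y \<noteq> ?z"
    by (auto dest: arg_cong[where f = "\<lambda>v. v $ 0"] arg_cong[where f = "\<lambda>v. v $ 1"]
        simp: vec_of_list_index simp del: vec_of_list_Cons)
  have res: "i mod 6 = 0 \<or> i mod 6 = 1 \<or> i mod 6 = 2 \<or> i mod 6 = 3 \<or> i mod 6 = 4 \<or> i mod 6 = 5"
    for i :: int
    by presburger
  have null_iff: "v \<in> null_space G \<longleftrightarrow> v \<in> carrier_vec 6 \<and>
      (\<forall>i. cyc 6 v (i + 4) + cyc 6 v (i + 3) + cyc 6 v (i + 1) + cyc 6 v i = 0)" for v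
    using null_space_iff[of v] by (simp add: add.assoc)
  have ker: "v \<in> null_space G" if "v \<in> ?B" for v
  proof -
    have "cyc 6 v (i + 4) + cyc 6 v (i + 3) + cyc 6 v (i + 1) + cyc 6 v i = 0" for i
      using res[of i] that
      by (auto simp: cyc_def vec_of_list_index simp del: vec_of_list_Cons simp flip: mod_add_left_eq[of i 6])
    moreover have "v \<in> carrier_vec 6"
      using that by (elim insertE emptyE) (simp_all add: carrier_dim_vec del: vec_of_list_Cons)
    ultimately show ?thesis
      unfolding null_iff by blast
  qed
  have zero: "v = 0\<^sub>v 6" if v: "v \<in> null_space G" "v $ 0 = 0" "v $ 1 = 0" "v $ 2 = 0" for v
  proof (rule eq_vecI)
    have eq: "cyc 6 v (i + 4) + cyc 6 v (i + 3) + cyc 6 v (i + 1) + cyc 6 v i = 0" for i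
      using v(1) unfolding null_iff by blast
    \<comment> \<open>With the first three entries zero, the equations at 0, 1 and 5 read v4 = -v3,
      v5 = -v4 and v3 = -v5, whence v3 = -v3.\<close>
    have "v $ 3 = 0" "v $ 4 = 0" "v $ 5 = 0"
      using eq[of 0] eq[of 1] eq[of 5] v(2-4) by (simp_all add: cyc_def)
    then show "v $ i = 0\<^sub>v 6 $ i" if "i < dim_vec (0\<^sub>v 6 :: real vec)" for i
      using that v(2-4) by (auto simp: less_Suc_eq numeral_eq_Suc)
  qed (use v(1) null_iff in auto)
  have "mat_kernel (adjacency_matrix G) = real_span 6 ?B \<and> kernel_dim (adjacency_matrix G) = card ?B"
  proof (rule mat_kernel_eq_span[OF adjacency_matrix_carrier,
      where pivot = "\<lambda>b. if b = ?x then 0 else if b = ?y then 1 else 2"])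
    show "?B \<subseteq> mat_kernel (adjacency_matrix G)"
      using ker by (auto simp: null_space_def)
    show "v = 0\<^sub>v 6" if "v \<in> mat_kernel (adjacency_matrix G)"
      "\<And>b. b \<in> ?B \<Longrightarrow> v $ (if b = ?x then 0 else if b = ?y then 1 else 2) = 0" for v
      using zero[of v] that(1) that(2)[of ?x] that(2)[of ?y] that(2)[of ?z] neq
      by (auto simp: null_space_def)
  qed (use neq in \<open>auto simp: vec_of_list_index simp del: vec_of_list_Cons\<close>)
  then show "null_space G = real_span 6 ?B" "nullity G = 3"
    using neq by (simp_all add: null_space_def nullity_def)
qed

theorem theorem9:
  fixes n :: nat
  assumes "n \<ge> 5"
  shows
    "(odd n \<longrightarrow>
       min_nullity n = 0 \<and>
       (\<forall>p q. 1 \<le> p \<and> p < q \<and> real q < real n / 2 \<longrightarrow>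
          (attains_min_nullity n (circ n {p, q}) \<longleftrightarrow> gcd p (gcd q n) = 1) \<and>
          (attains_min_nullity n (circ n {p, q}) \<longrightarrow> null_space (circ n {p, q}) = {0\<^sub>v n})))
     \<and>
     (n = 6 \<longrightarrow>
       min_nullity n = 3 \<and>
       (\<forall>p q. 1 \<le> p \<and> p < q \<and> real q < real n / 2 \<longrightarrow>
          (attains_min_nullity n (circ n {p, q}) \<longleftrightarrow> p = 1 \<and> q = 2)) \<and>
       attains_min_nullity n (circ n {1, 2}) \<and>
       null_space (circ n {1, 2}) =
         real_span n {vec_of_list [1, 0, 0, -1, 0, 0],
                      vec_of_list [0, 1, 0, 0, -1, 0],
                      vec_of_list [0, 0, 1, 0, 0, -1]})
     \<and>
     (n \<ge> 8 \<and> 4 dvd n \<longrightarrow>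
       min_nullity n = 1 \<and>
       (\<forall>p q. 1 \<le> p \<and> p < q \<and> real q < real n / 2 \<longrightarrow>
          (attains_min_nullity n (circ n {p, q}) \<longleftrightarrow>
             \<not> [p = q] (mod 2) \<and> gcd n (p + q) = 1 \<and> gcd n (q - p) = 1) \<and>
          (attains_min_nullity n (circ n {p, q}) \<longrightarrow>
             null_space (circ n {p, q}) = real_span n {vec n (\<lambda>i. (-1) ^ i)})))
     \<and>
     (n \<ge> 10 \<and> [n = 2] (mod 4) \<longrightarrow>
       min_nullity n = 0 \<and>
       (\<forall>p q. 1 \<le> p \<and> p < q \<and> real q < real n / 2 \<longrightarrow>
          (attains_min_nullity n (circ n {p, q}) \<longleftrightarrow>
             odd p \<and> odd q \<and> gcd p (gcd q n) = 1) \<and>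
          (attains_min_nullity n (circ n {p, q}) \<longrightarrow> null_space (circ n {p, q}) = {0\<^sub>v n})))"
proof -
  have qc: "quartic_circ n p q" if "1 \<le> p \<and> p < q \<and> real q < real n / 2" for p q
    using that by unfold_locales auto
  have case_odd: "min_nullity n = 0 \<and> (\<forall>p q. 1 \<le> p \<and> p < q \<and> real q < real n / 2 \<longrightarrow>
      (attains_min_nullity n (circ n {p, q}) \<longleftrightarrow> gcd p (gcd q n) = 1) \<and>
      (attains_min_nullity n (circ n {p, q}) \<longrightarrow> null_space (circ n {p, q}) = {0\<^sub>v n}))"
    if "odd n"
  proof -
    have triv: "null_space (circ n {p, q}) = {0\<^sub>v n} \<and> nullity (circ n {p, q}) = 0"
      if "quartic_circ n p q" for p q
      using quartic_circ.null_space_trivial[OF that \<open>odd n\<close>] by simp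
    have wit: "quartic_circ n 1 2"
      using assms by unfold_locales auto
    have "min_nullity n = 0"
      by (rule min_nullity_eqI[OF _ wit]) (use triv[OF wit] in auto)
    then show ?thesis
      using quartic_circ.attains_iff[OF qc] triv[OF qc] by simp
  qed
  have case_six: "min_nullity n = 3 \<and>
      (\<forall>p q. 1 \<le> p \<and> p < q \<and> real q < real n / 2 \<longrightarrow>
         (attains_min_nullity n (circ n {p, q}) \<longleftrightarrow> p = 1 \<and> q = 2)) \<and>
      attains_min_nullity n (circ n {1, 2}) \<and>
      null_space (circ n {1, 2}) =
        real_span n {vec_of_list [1, 0, 0, -1, 0, 0],
                     vec_of_list [0, 1, 0, 0, -1, 0],
                     vec_of_list [0, 0, 1, 0, 0, -1]}"
    if "n = 6"
  proof -
    have pq: "p = 1 \<and> q = 2" if "quartic_circ n p q" for p q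
      using that \<open>n = 6\<close> unfolding quartic_circ_def by linarith
    have wit: "quartic_circ n 1 2"
      using \<open>n = 6\<close> by unfold_locales auto
    have nullity: "nullity (circ n {1, 2}) = 3"
      using octahedron_null_space(2) \<open>n = 6\<close> by simp
    have min: "min_nullity n = 3"
    proof (rule min_nullity_eqI[OF _ wit])
      show "3 \<le> nullity (circ n {p, q})" if "quartic_circ n p q" for p q
        using pq[OF that] nullity by simp
    qed (use nullity in auto)
    have attains: "attains_min_nullity n (circ n {1, 2})"
      using quartic_circ.attains_iff[OF wit] nullity min by simp
    with min pq[OF qc] octahedron_null_space(1) \<open>n = 6\<close> show ?thesis
      by blast
  qed
  have case_4: "min_nullity n = 1 \<and>
      (\<forall>p q. 1 \<le> p \<and> p < q \<and> real q < real n / 2 \<longrightarrow>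
         (attains_min_nullity n (circ n {p, q}) \<longleftrightarrow>
            \<not> [p = q] (mod 2) \<and> gcd n (p + q) = 1 \<and> gcd n (q - p) = 1) \<and>
         (attains_min_nullity n (circ n {p, q}) \<longrightarrow>
            null_space (circ n {p, q}) = real_span n {vec n (\<lambda>i. (-1) ^ i)}))"
    if n: "n \<ge> 8" "4 dvd n"
  proof -
    have even: "even n"
      using n(2) by (meson dvd_trans even_numeral)
    \<comment> \<open>Connectedness rules out p and q both even, and nullity below 2 rules out both
      odd. So p + q and q - p are odd, and a common factor of either with n would again give nullity
      at least 2.\<close>
    have small: "gcd n (p + q) = 1 \<and> gcd n (q - p) = 1"
      if pq: "quartic_circ n p q" "gcd p (gcd q n) = 1" "nullity (circ n {p, q}) < 2" for p q
    proof -
      have "odd p \<or> odd q"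
        using pq(2) even by (metis gcd_greatest odd_one)
      moreover have "\<not> (odd p \<and> odd q)"
        using quartic_circ.two_le_nullity_if_both_odd[OF pq(1) n(2)] pq(3) by linarith
      ultimately have "odd (p + q)" "odd (q - p)"
        using quartic_circ.p_less_q[OF pq(1)] by auto
      with quartic_circ.two_le_nullity_if_common_factor[OF pq(1) even] pq(3) show ?thesis
        by (meson insertCI not_le)
    qed
    have alt: "null_space (circ n {p, q}) = real_span n {vec n (\<lambda>i. (-1) ^ i)} \<and>
        nullity (circ n {p, q}) = 1 \<and> gcd p (gcd q n) = 1 \<and> \<not> [p = q] (mod 2)"
      if pq: "quartic_circ n p q" "gcd n (p + q) = 1" "gcd n (q - p) = 1" for p q
    proof -
      \<comment> \<open>A common divisor of p, q and n divides n and p + q, so coprimality already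
        entails connectedness.\<close>
      have "gcd p (gcd q n) dvd gcd n (p + q)"
        by (meson dvd_add dvd_trans gcd_dvd1 gcd_dvd2 gcd_greatest)
      moreover have "odd (p + q)"
        using even pq(2) by (metis gcd_greatest odd_one)
      then have "\<not> [p = q] (mod 2)"
        unfolding cong_def by presburger
      ultimately show ?thesis
        using quartic_circ.null_space_alternating[OF pq(1) even pq(2,3)] pq(2) by simp
    qed
    obtain m where m: "n = 4 * m"
      using n(2) by (rule dvdE)
    \<comment> \<open>The jumps n/4 and n/4 + 1 work for every such n: their difference is 1, and
      their sum n/2 + 1 is odd, while its gcd with n divides 2(n/2 + 1) - n = 2. The pair 1, 2 would
      fail when 3 divides n. The bound n >= 8 ensures 2(m + 1) < n.\<close>
    have wit: "quartic_circ n m (m + 1)"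
      using n(1) m by unfold_locales auto
    have "gcd n (m + (m + 1)) = 1"
    proof -
      let ?g = "gcd n (m + (m + 1))"
      have "?g dvd 2 * (m + (m + 1)) - n"
        by (intro dvd_diff_nat dvd_mult) auto
      then have "?g dvd 2"
        using m by simp
      then have "?g \<le> 2"
        by (rule dvd_imp_le) simp
      moreover have "odd ?g"
      proof
        assume "even ?g"
        then have "even (m + (m + 1))"
          by (rule dvd_trans) simp
        then show False by simp
      qed
      ultimately show ?thesis
        by presburger
    qed
    from alt[OF wit this] have wit': "nullity (circ n {m, m + 1}) = 1" "gcd m (gcd (m + 1) n) = 1"
      by auto
    have min: "min_nullity n = 1"
    proof (rule min_nullity_eqI[OF _ wit wit'(2,1)])
      fix p q assume pq: "quartic_circ n p q" "gcd p (gcd q n) = 1"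
      \<comment> \<open>If the nullity is below 2, then \<open>small\<close> gives coprimality and
        \<open>alt\<close> makes it exactly 1.\<close>
      show "1 \<le> nullity (circ n {p, q})"
        using small[OF pq] alt[OF pq(1)] by fastforce
    qed
    have main: "(attains_min_nullity n (circ n {p, q}) \<longleftrightarrow>
            \<not> [p = q] (mod 2) \<and> gcd n (p + q) = 1 \<and> gcd n (q - p) = 1) \<and>
         (attains_min_nullity n (circ n {p, q}) \<longrightarrow>
            null_space (circ n {p, q}) = real_span n {vec n (\<lambda>i. (-1) ^ i)})"
      if "quartic_circ n p q" for p q
    proof -
      have "attains_min_nullity n (circ n {p, q}) \<longleftrightarrow> gcd n (p + q) = 1 \<and> gcd n (q - p) = 1"
        using quartic_circ.attains_iff[OF that] min small[OF that] alt[OF that] by auto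
      then show ?thesis
        using alt[OF that] by auto
    qed
    show ?thesis
      by (intro conjI[OF min] allI impI main qc)
  qed
  have case_2: "min_nullity n = 0 \<and>
      (\<forall>p q. 1 \<le> p \<and> p < q \<and> real q < real n / 2 \<longrightarrow>
         (attains_min_nullity n (circ n {p, q}) \<longleftrightarrow>
            odd p \<and> odd q \<and> gcd p (gcd q n) = 1) \<and>
         (attains_min_nullity n (circ n {p, q}) \<longrightarrow> null_space (circ n {p, q}) = {0\<^sub>v n}))"
    if n: "n \<ge> 10" "[n = 2] (mod 4)"
  proof -
    obtain k where k: "n = 2 * k" "odd k"
    proof
      show "n = 2 * (n div 2)" "odd (n div 2)"
        using n(2) unfolding cong_def by presburger+
    qed
    \<comment> \<open>For p and q odd, p + q and q - p are even, so n = 2k divides their products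
      with the odd number k.\<close>
    have triv: "null_space (circ n {p, q}) = {0\<^sub>v n} \<and> nullity (circ n {p, q}) = 0"
      if "quartic_circ n p q" "odd p" "odd q" for p q
      using that k by (intro quartic_circ.null_space_trivial[of n p q k]) auto
    have odd: "odd p \<and> odd q"
      if pq: "quartic_circ n p q" "gcd p (gcd q n) = 1" "nullity (circ n {p, q}) = 0" for p q
    proof -
      have "odd p \<or> odd q"
        using pq(2) k(1) by (metis dvd_triv_left gcd_greatest odd_one)
      \<comment> \<open>Opposite parities would put the alternating vector into the null
        space.\<close>
      moreover have "even (p + q)"
        using quartic_circ.one_le_nullity[OF pq(1)] k(1) pq(3) by fastforce
      ultimately show ?thesis by simp
    qed
    \<comment> \<open>The smallest pair of distinct odd jumps needs 2 * 3 < n, which fails for n =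
      6; hence the separate treatment of that order.\<close>
    have wit: "quartic_circ n 1 3"
      using n(1) by unfold_locales auto
    have min: "min_nullity n = 0"
      by (rule min_nullity_eqI[OF _ wit]) (use triv[OF wit] in auto)
    have main: "(attains_min_nullity n (circ n {p, q}) \<longleftrightarrow> odd p \<and> odd q \<and> gcd p (gcd q n) = 1) \<and>
         (attains_min_nullity n (circ n {p, q}) \<longrightarrow> null_space (circ n {p, q}) = {0\<^sub>v n})"
      if "quartic_circ n p q" for p q
      using quartic_circ.attains_iff[OF that] min odd[OF that] triv[OF that] by metis
    show ?thesis
      by (intro conjI[OF min] allI impI main qc)
  qed
  show ?thesis
  proof (intro conjI, goal_cases)
    case 1
    show ?case by (intro impI case_odd)
  next
    case 2
    show ?case by (intro impI case_six)
  next
    case 3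
    show ?case by (intro impI case_4) auto
  next
    case 4
    show ?case by (intro impI case_2) auto
  qed
qed

end
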